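(* Let $Q$ be an automorphic loop. The following properties are equivalent: (i) $Q$ has the left alternative property, i.e. $x(xy)=(xx)y$ for all $x,y\in Q$; (ii) $Q$ has the right alternative property, i.e. $x(yy)=(xy)y$ for all $x,y\in Q$; (iii) $Q$ has the left inverse property, i.e. $x^{-1}(xy)=y$ for all $x,y\in Q$; (iv) $Q$ has the right inverse property, i.e. $(xy)y^{-1}=x$ for all $x,y\in Q$; (v) $Q$ is diassociative, i.e. any two elements of $Q$ generate an associative subloop; (vi) $Q$ is a Moufang loop, i.e. $(xy)(zx)=(x(yz))x$ for all $x,y,z\in Q$.
   Context: A loop is a set $Q$ with a binary operation and a two-sided identity element $1$ such that all left translations $L_x(y)=xy$ and right translations $R_x(y)=yx$ are bijections of $Q$; one writes $x\backslash y=L_x^{-1}(y)$ and $y/x=R_x^{-1}(y)$. The multiplication group $\mathrm{Mlt}(Q)$ is the permutation group generated by all $L_x,R_x$, and the inner mapping group $\mathrm{Inn}(Q)$ is the stabilizer of $1$ in $\mathrm{Mlt}(Q)$. A loop $Q$ is automorphic if $\mathrm{Inn}(Q)\le\mathrm{Aut}(Q)$. In an automorphic loop every element $x$ has a two-sided inverse $x^{-1}$ (so $xx^{-1}=x^{-1}x=1$). *)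

theory Defs
  imports "HOL-Algebra.Bij" "HOL-Algebra.Generated_Groups"
begin

(* Translations are restricted to the carrier because Bij, BijGroup and auto
   only contain extensional functions. *)

definition ltrans :: "('a, 'b) monoid_scheme \<Rightarrow> 'a \<Rightarrow> 'a \<Rightarrow> 'a" where
  "ltrans Q x = (\<lambda>y\<in>carrier Q. x \<otimes>\<^bsub>Q\<^esub> y)"

definition rtrans :: "('a, 'b) monoid_scheme \<Rightarrow> 'a \<Rightarrow> 'a \<Rightarrow> 'a" where
  "rtrans Q x = (\<lambda>y\<in>carrier Q. y \<otimes>\<^bsub>Q\<^esub> x)"

locale loop =
  fixes Q :: "('a, 'b) monoid_scheme" (structure)
  assumes one_closed: "\<one> \<in> carrier Q"
    and l_one: "x \<in> carrier Q \<Longrightarrow> \<one> \<otimes> x = x"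
    and r_one: "x \<in> carrier Q \<Longrightarrow> x \<otimes> \<one> = x"
    and ltrans_bij: "x \<in> carrier Q \<Longrightarrow> bij_betw (ltrans Q x) (carrier Q) (carrier Q)"
    and rtrans_bij: "x \<in> carrier Q \<Longrightarrow> bij_betw (rtrans Q x) (carrier Q) (carrier Q)"

(* ldiv Q x y is x \ y, the solution z of x z = y;
   rdiv Q y x is y / x, the solution z of z x = y. *)

definition ldiv :: "('a, 'b) monoid_scheme \<Rightarrow> 'a \<Rightarrow> 'a \<Rightarrow> 'a" where
  "ldiv Q x y = inv_into (carrier Q) (ltrans Q x) y"

definition rdiv :: "('a, 'b) monoid_scheme \<Rightarrow> 'a \<Rightarrow> 'a \<Rightarrow> 'a" where
  "rdiv Q y x = inv_into (carrier Q) (rtrans Q x) y"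

definition Mlt :: "('a, 'b) monoid_scheme \<Rightarrow> ('a \<Rightarrow> 'a) set" where
  "Mlt Q = generate (BijGroup (carrier Q)) (ltrans Q ` carrier Q \<union> rtrans Q ` carrier Q)"

definition Inn :: "('a, 'b) monoid_scheme \<Rightarrow> ('a \<Rightarrow> 'a) set" where
  "Inn Q = {f \<in> Mlt Q. f \<one>\<^bsub>Q\<^esub> = \<one>\<^bsub>Q\<^esub>}"

locale automorphic_loop = loop +
  assumes Inn_subset_auto: "Inn Q \<subseteq> auto Q"

definition subloop :: "'a set \<Rightarrow> ('a, 'b) monoid_scheme \<Rightarrow> bool" where
  "subloop H Q \<longleftrightarrow> H \<subseteq> carrier Q \<and> \<one>\<^bsub>Q\<^esub> \<in> H \<and>
     (\<forall>x\<in>H. \<forall>y\<in>H. x \<otimes>\<^bsub>Q\<^esub> y \<in> H \<and> ldiv Q x y \<in> H \<and> rdiv Q y x \<in> H)"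

definition subloop_generated :: "('a, 'b) monoid_scheme \<Rightarrow> 'a set \<Rightarrow> 'a set" where
  "subloop_generated Q S = \<Inter>{H. subloop H Q \<and> S \<subseteq> H}"

definition associative_on :: "('a, 'b) monoid_scheme \<Rightarrow> 'a set \<Rightarrow> bool" where
  "associative_on Q H \<longleftrightarrow>
     (\<forall>x\<in>H. \<forall>y\<in>H. \<forall>z\<in>H. (x \<otimes>\<^bsub>Q\<^esub> y) \<otimes>\<^bsub>Q\<^esub> z = x \<otimes>\<^bsub>Q\<^esub> (y \<otimes>\<^bsub>Q\<^esub> z))"

definition left_alternative :: "('a, 'b) monoid_scheme \<Rightarrow> bool" where
  "left_alternative Q \<longleftrightarrow>
     (\<forall>x\<in>carrier Q. \<forall>y\<in>carrier Q. x \<otimes>\<^bsub>Q\<^esub> (x \<otimes>\<^bsub>Q\<^esub> y) = (x \<otimes>\<^bsub>Q\<^esub> x) \<otimes>\<^bsub>Q\<^esub> y)"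

definition right_alternative :: "('a, 'b) monoid_scheme \<Rightarrow> bool" where
  "right_alternative Q \<longleftrightarrow>
     (\<forall>x\<in>carrier Q. \<forall>y\<in>carrier Q. x \<otimes>\<^bsub>Q\<^esub> (y \<otimes>\<^bsub>Q\<^esub> y) = (x \<otimes>\<^bsub>Q\<^esub> y) \<otimes>\<^bsub>Q\<^esub> y)"

(* The library inverse is the unique two-sided inverse; automorphic loops have one
   (lemma two_sided_inverse below), loops in general need not. *)

definition left_inverse_property :: "('a, 'b) monoid_scheme \<Rightarrow> bool" where
  "left_inverse_property Q \<longleftrightarrow>
     (\<forall>x\<in>carrier Q. \<forall>y\<in>carrier Q. inv\<^bsub>Q\<^esub> x \<otimes>\<^bsub>Q\<^esub> (x \<otimes>\<^bsub>Q\<^esub> y) = y)"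

definition right_inverse_property :: "('a, 'b) monoid_scheme \<Rightarrow> bool" where
  "right_inverse_property Q \<longleftrightarrow>
     (\<forall>x\<in>carrier Q. \<forall>y\<in>carrier Q. (x \<otimes>\<^bsub>Q\<^esub> y) \<otimes>\<^bsub>Q\<^esub> inv\<^bsub>Q\<^esub> y = x)"

definition diassociative :: "('a, 'b) monoid_scheme \<Rightarrow> bool" where
  "diassociative Q \<longleftrightarrow>
     (\<forall>x\<in>carrier Q. \<forall>y\<in>carrier Q. associative_on Q (subloop_generated Q {x, y}))"

definition moufang :: "('a, 'b) monoid_scheme \<Rightarrow> bool" where
  "moufang Q \<longleftrightarrow>
     (\<forall>x\<in>carrier Q. \<forall>y\<in>carrier Q. \<forall>z\<in>carrier Q.
        (x \<otimes>\<^bsub>Q\<^esub> y) \<otimes>\<^bsub>Q\<^esub> (z \<otimes>\<^bsub>Q\<^esub> x) = (x \<otimes>\<^bsub>Q\<^esub> (y \<otimes>\<^bsub>Q\<^esub> z)) \<otimes>\<^bsub>Q\<^esub> x)"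

context loop
begin

lemma m_closed: "x \<in> carrier Q \<Longrightarrow> y \<in> carrier Q \<Longrightarrow> x \<otimes> y \<in> carrier Q"
  using bij_betw_apply[OF ltrans_bij] by (fastforce simp: ltrans_def)

lemma ltrans_Bij: "x \<in> carrier Q \<Longrightarrow> ltrans Q x \<in> Bij (carrier Q)"
  using ltrans_bij by (auto simp: Bij_def ltrans_def)

lemma rtrans_Bij: "x \<in> carrier Q \<Longrightarrow> rtrans Q x \<in> Bij (carrier Q)"
  using rtrans_bij by (auto simp: Bij_def rtrans_def)

lemma ldiv:
  assumes "x \<in> carrier Q" "y \<in> carrier Q"
  shows "ldiv Q x y \<in> carrier Q" "x \<otimes> ldiv Q x y = y"
proof -
  have im: "y \<in> ltrans Q x ` carrier Q"
    using ltrans_bij[OF assms(1)] assms(2) by (simp add: bij_betw_def)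
  show c: "ldiv Q x y \<in> carrier Q"
    unfolding ldiv_def by (rule inv_into_into[OF im])
  show "x \<otimes> ldiv Q x y = y"
    using f_inv_into_f[OF im] c by (simp add: ldiv_def ltrans_def)
qed

lemma rdiv:
  assumes "x \<in> carrier Q" "y \<in> carrier Q"
  shows "rdiv Q y x \<in> carrier Q" "rdiv Q y x \<otimes> x = y"
proof -
  have im: "y \<in> rtrans Q x ` carrier Q"
    using rtrans_bij[OF assms(1)] assms(2) by (simp add: bij_betw_def)
  show c: "rdiv Q y x \<in> carrier Q"
    unfolding rdiv_def by (rule inv_into_into[OF im])
  show "rdiv Q y x \<otimes> x = y"
    using f_inv_into_f[OF im] c by (simp add: rdiv_def rtrans_def)
qed

lemma l_cancel:
  assumes "x \<in> carrier Q" "y \<in> carrier Q" "z \<in> carrier Q" "x \<otimes> y = x \<otimes> z"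
  shows "y = z"
  using ltrans_bij[OF assms(1)] assms by (auto simp: bij_betw_def inj_on_def ltrans_def)

lemma r_cancel:
  assumes "x \<in> carrier Q" "y \<in> carrier Q" "z \<in> carrier Q" "y \<otimes> x = z \<otimes> x"
  shows "y = z"
  using rtrans_bij[OF assms(1)] assms by (auto simp: bij_betw_def inj_on_def rtrans_def)

lemma conj_in_Mlt:
  assumes "x \<in> carrier Q"
  shows "(\<lambda>y\<in>carrier Q. rdiv Q (x \<otimes> y) x) \<in> Mlt Q"
proof -
  let ?B = "BijGroup (carrier Q)"
  have "inv\<^bsub>?B\<^esub> (rtrans Q x) \<otimes>\<^bsub>?B\<^esub> ltrans Q x \<in> Mlt Q"
    unfolding Mlt_def by (intro generate.eng generate.inv generate.incl) (use assms in auto)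
  also have "inv\<^bsub>?B\<^esub> (rtrans Q x) \<otimes>\<^bsub>?B\<^esub> ltrans Q x =
      compose (carrier Q) (restrict (inv_into (carrier Q) (rtrans Q x)) (carrier Q)) (ltrans Q x)"
    using rtrans_Bij[OF assms] ltrans_Bij[OF assms]
    by (simp only: inv_BijGroup) (simp add: BijGroup_def restrict_inv_into_Bij)
  also have "\<dots> = (\<lambda>y\<in>carrier Q. rdiv Q (x \<otimes> y) x)"
    using assms by (auto simp: compose_def rdiv_def ltrans_def m_closed fun_eq_iff)
  finally show ?thesis .
qed

end

lemma (in automorphic_loop) two_sided_inverse:
  assumes x: "x \<in> carrier Q"
  shows "inv x \<in> carrier Q" "x \<otimes> inv x = \<one>" "inv x \<otimes> x = \<one>"
proof -
  define T where "T = (\<lambda>y\<in>carrier Q. rdiv Q (x \<otimes> y) x)"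
  define r where "r = ldiv Q x \<one>"
  have r: "r \<in> carrier Q" "x \<otimes> r = \<one>"
    using ldiv x one_closed by (auto simp: r_def)
  have Tx: "T y \<otimes> x = x \<otimes> y" "T y \<in> carrier Q" if "y \<in> carrier Q" for y
    using that x by (auto simp: T_def m_closed rdiv)
  have T1: "T \<one> = \<one>"
    by (rule r_cancel[of x]) (use x one_closed Tx[of \<one>] in \<open>auto simp: l_one r_one\<close>)
  have Txx: "T x = x"
    by (rule r_cancel[of x]) (use x Tx[of x] in auto)
  have "T \<in> auto Q"
    using Inn_subset_auto conj_in_Mlt[OF x] T1 by (auto simp: Inn_def T_def)
  then have "T (x \<otimes> r) = T x \<otimes> T r"
    using x r(1) by (simp add: auto_def hom_def)
  then have "x \<otimes> T r = x \<otimes> r"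
    using T1 Txx r by simp
  then have "T r = r"
    using l_cancel x r Tx by blast
  then have rx: "r \<otimes> x = \<one>"
    using Tx(1)[of r] r by simp
  have "inv x = r"
    unfolding m_inv_def
    by (rule the_equality) (use r rx x l_cancel in \<open>auto\<close>)
  then show "inv x \<in> carrier Q" "x \<otimes> inv x = \<one>" "inv x \<otimes> x = \<one>"
    using r rx by auto
qed

end

theory Submission
  imports Defs
begin

text \<open>
  Three inner mappings carry the argument: \<open>R\<^sub>x\<^sup>-\<^sup>1 L\<^sub>x\<close>, the left inner mapping
  \<open>L\<^sub>x\<^sub>y\<^sup>-\<^sup>1 L\<^sub>x L\<^sub>y\<close>, which fixes \<open>z\<close> iff \<open>(xy)z = x(yz)\<close>, and the middle inner mapping
  \<open>L\<^sub>x\<^sup>-\<^sup>1 R\<^sub>y\<^sup>-\<^sup>1 L\<^sub>x R\<^sub>y\<close>, which fixes \<open>z\<close> iff \<open>(xz)y = x(zy)\<close>. The first one commutes with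
  \<open>L\<^sub>x\<close>, so automorphic loops are flexible; hence the left inner mapping of \<open>x, y\<close> fixes \<open>x\<close>, and
  evaluating it at \<open>y\<^sup>-\<^sup>1\<close> and at the solution \<open>u\<close> of \<open>yu = x\<^sup>-\<^sup>1\<close> shows that inversion is an
  antiautomorphism. Inversion therefore exchanges left and right properties.

  If \<open>Q\<close> is alternative, the middle inner mapping of \<open>x, y\<close> fixes \<open>x\<close> and \<open>y\<close>, hence every element
  \<open>w\<close> of the subloop \<open>H\<close> they generate; so the left inner mapping of \<open>x, w\<close> fixes \<open>x\<close> and \<open>y\<close>
  as well, which puts \<open>x\<close>, and symmetrically \<open>y\<close>, into the left nucleus of \<open>H\<close>.

  For the Moufang identity write \<open>\<phi>(x,y)\<close> for the left and \<open>\<psi>(x,y)\<close> for the middle inner mapping.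
  The right alternative law gives \<open>\<phi>(x,yz)z = \<phi>(x,y)z\<close>, and a comparison of both mappings gives
  \<open>\<phi>(x,y)z = \<psi>(y,xz)z\<close>. Together they force \<open>\<phi>(x,y) = \<psi>(y,x)\<close>, which is the Moufang identity.
\<close>

section \<open>Inner mappings\<close>

definition left_inner :: "('a, 'b) monoid_scheme \<Rightarrow> 'a \<Rightarrow> 'a \<Rightarrow> 'a \<Rightarrow> 'a" where
  "left_inner Q x y = (\<lambda>z\<in>carrier Q. ldiv Q (x \<otimes>\<^bsub>Q\<^esub> y) (x \<otimes>\<^bsub>Q\<^esub> (y \<otimes>\<^bsub>Q\<^esub> z)))"

definition middle_inner :: "('a, 'b) monoid_scheme \<Rightarrow> 'a \<Rightarrow> 'a \<Rightarrow> 'a \<Rightarrow> 'a" where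
  "middle_inner Q x y = (\<lambda>z\<in>carrier Q. ldiv Q x (rdiv Q (x \<otimes>\<^bsub>Q\<^esub> (z \<otimes>\<^bsub>Q\<^esub> y)) y))"

context loop
begin

declare one_closed [simp] l_one [simp] r_one [simp] m_closed [simp] ldiv [simp] rdiv [simp]

lemma ldiv_mult [simp]: "\<lbrakk>x \<in> carrier Q; y \<in> carrier Q\<rbrakk> \<Longrightarrow> ldiv Q x (x \<otimes> y) = y"
  using l_cancel[of x "ldiv Q x (x \<otimes> y)" y] by simp

lemma rdiv_mult [simp]: "\<lbrakk>x \<in> carrier Q; y \<in> carrier Q\<rbrakk> \<Longrightarrow> rdiv Q (y \<otimes> x) x = y"
  using r_cancel[of x "rdiv Q (y \<otimes> x) x" y] by simp

text \<open>Multiplication in \<open>BijGroup\<close> is composition only between members of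
  \<open>Bij\<close>; this inclusion allows products in \<open>Mlt Q\<close> to be computed by
  \<open>compose\<close>.\<close>

lemma Mlt_subset_Bij: "Mlt Q \<subseteq> Bij (carrier Q)"
  unfolding Mlt_def
  using group.generate_incl[OF group_BijGroup,
      of "ltrans Q ` carrier Q \<union> rtrans Q ` carrier Q" "carrier Q"]
    ltrans_Bij rtrans_Bij by (auto simp: BijGroup_def)

lemma compose_in_Mlt:
  assumes "f \<in> Mlt Q" "g \<in> Mlt Q"
  shows "compose (carrier Q) f g \<in> Mlt Q"
proof -
  have "f \<otimes>\<^bsub>BijGroup (carrier Q)\<^esub> g \<in> Mlt Q"
    using assms unfolding Mlt_def by (rule generate.eng)
  moreover have "f \<in> Bij (carrier Q)" "g \<in> Bij (carrier Q)"
    using assms Mlt_subset_Bij by auto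
  ultimately show ?thesis
    by (simp add: BijGroup_def)
qed

lemma ltrans_in_Mlt: "x \<in> carrier Q \<Longrightarrow> ltrans Q x \<in> Mlt Q"
  unfolding Mlt_def by (auto intro: generate.incl)

lemma rtrans_in_Mlt: "x \<in> carrier Q \<Longrightarrow> rtrans Q x \<in> Mlt Q"
  unfolding Mlt_def by (auto intro: generate.incl)

lemma ldiv_in_Mlt:
  assumes "x \<in> carrier Q"
  shows "(\<lambda>y\<in>carrier Q. ldiv Q x y) \<in> Mlt Q"
proof -
  have "inv\<^bsub>BijGroup (carrier Q)\<^esub> (ltrans Q x) \<in> Mlt Q"
    unfolding Mlt_def using assms by (auto intro: generate.inv)
  then show ?thesis
    using assms by (simp add: inv_BijGroup ltrans_Bij ldiv_def)
qed

lemma rdiv_in_Mlt: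
  assumes "x \<in> carrier Q"
  shows "(\<lambda>y\<in>carrier Q. rdiv Q y x) \<in> Mlt Q"
proof -
  have "inv\<^bsub>BijGroup (carrier Q)\<^esub> (rtrans Q x) \<in> Mlt Q"
    unfolding Mlt_def using assms by (auto intro: generate.inv)
  then show ?thesis
    using assms by (simp add: inv_BijGroup rtrans_Bij rdiv_def)
qed

lemma left_inner_in_Inn:
  assumes "x \<in> carrier Q" "y \<in> carrier Q"
  shows "left_inner Q x y \<in> Inn Q"
proof -
  have "left_inner Q x y = compose (carrier Q) (\<lambda>z\<in>carrier Q. ldiv Q (x \<otimes> y) z)
      (compose (carrier Q) (ltrans Q x) (ltrans Q y))"
    using assms by (auto simp: left_inner_def compose_def ltrans_def fun_eq_iff)
  then have "left_inner Q x y \<in> Mlt Q"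
    using assms by (simp add: compose_in_Mlt ltrans_in_Mlt ldiv_in_Mlt)
  then show ?thesis
    using assms ldiv_mult[of "x \<otimes> y" \<one>] by (simp add: Inn_def left_inner_def)
qed

lemma middle_inner_in_Inn:
  assumes "x \<in> carrier Q" "y \<in> carrier Q"
  shows "middle_inner Q x y \<in> Inn Q"
proof -
  have "middle_inner Q x y = compose (carrier Q) (\<lambda>z\<in>carrier Q. ldiv Q x z)
      (compose (carrier Q) (\<lambda>z\<in>carrier Q. rdiv Q z y)
        (compose (carrier Q) (ltrans Q x) (rtrans Q y)))"
    using assms by (auto simp: middle_inner_def compose_def ltrans_def rtrans_def fun_eq_iff)
  then have "middle_inner Q x y \<in> Mlt Q"
    using assms by (simp add: compose_in_Mlt ltrans_in_Mlt rtrans_in_Mlt ldiv_in_Mlt rdiv_in_Mlt)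
  then show ?thesis
    using assms ldiv_mult[of x \<one>] by (simp add: Inn_def middle_inner_def)
qed

lemma left_inner_closed [simp]:
  "\<lbrakk>x \<in> carrier Q; y \<in> carrier Q; z \<in> carrier Q\<rbrakk> \<Longrightarrow> left_inner Q x y z \<in> carrier Q"
  by (simp add: left_inner_def)

lemma middle_inner_closed [simp]:
  "\<lbrakk>x \<in> carrier Q; y \<in> carrier Q; z \<in> carrier Q\<rbrakk> \<Longrightarrow> middle_inner Q x y z \<in> carrier Q"
  by (simp add: middle_inner_def)

lemma mult_left_inner:
  "\<lbrakk>x \<in> carrier Q; y \<in> carrier Q; z \<in> carrier Q\<rbrakk>
    \<Longrightarrow> (x \<otimes> y) \<otimes> left_inner Q x y z = x \<otimes> (y \<otimes> z)"
  by (simp add: left_inner_def)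

lemma mult_middle_inner:
  "\<lbrakk>x \<in> carrier Q; y \<in> carrier Q; z \<in> carrier Q\<rbrakk>
    \<Longrightarrow> (x \<otimes> middle_inner Q x y z) \<otimes> y = x \<otimes> (z \<otimes> y)"
  by (simp add: middle_inner_def)

lemma left_inner_eqI:
  assumes "x \<in> carrier Q" "y \<in> carrier Q" "z \<in> carrier Q" "w \<in> carrier Q"
    and "(x \<otimes> y) \<otimes> w = x \<otimes> (y \<otimes> z)"
  shows "left_inner Q x y z = w"
  using assms l_cancel[of "x \<otimes> y" "left_inner Q x y z" w] by (simp add: mult_left_inner)

lemma middle_inner_eqI:
  assumes "x \<in> carrier Q" "y \<in> carrier Q" "z \<in> carrier Q" "w \<in> carrier Q"
    and "(x \<otimes> w) \<otimes> y = x \<otimes> (z \<otimes> y)"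
  shows "middle_inner Q x y z = w"
  using assms unfolding middle_inner_def by (metis ldiv_mult m_closed rdiv_mult restrict_apply')

text \<open>Turns associativity of a triple into a fixed point of an inner mapping, so that in an
  automorphic loop it spreads to inverses and generated subloops.\<close>

lemma left_inner_fixes_iff:
  "\<lbrakk>x \<in> carrier Q; y \<in> carrier Q; z \<in> carrier Q\<rbrakk>
    \<Longrightarrow> left_inner Q x y z = z \<longleftrightarrow> (x \<otimes> y) \<otimes> z = x \<otimes> (y \<otimes> z)"
  using left_inner_eqI mult_left_inner by metis

lemma middle_inner_fixes_iff:
  "\<lbrakk>x \<in> carrier Q; y \<in> carrier Q; z \<in> carrier Q\<rbrakk>
    \<Longrightarrow> middle_inner Q x y z = z \<longleftrightarrow> (x \<otimes> z) \<otimes> y = x \<otimes> (z \<otimes> y)"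
  using middle_inner_eqI mult_middle_inner by metis

section \<open>Subloops\<close>

lemma subloop_carrier: "subloop (carrier Q) Q"
  by (simp add: subloop_def)

lemma subloop_generated_subset: "S \<subseteq> subloop_generated Q S"
  by (auto simp: subloop_generated_def)

lemma subloop_generated_least: "\<lbrakk>subloop H Q; S \<subseteq> H\<rbrakk> \<Longrightarrow> subloop_generated Q S \<subseteq> H"
  by (auto simp: subloop_generated_def)

lemma subloop_subloop_generated:
  assumes "S \<subseteq> carrier Q"
  shows "subloop (subloop_generated Q S) Q"
  using assms subloop_carrier unfolding subloop_generated_def subloop_def by blast

lemma subloop_left_nucleus:
  assumes H: "subloop H Q"
  shows "subloop {a \<in> H. \<forall>v\<in>H. \<forall>w\<in>H. (a \<otimes> v) \<otimes> w = a \<otimes> (v \<otimes> w)} Q"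
    (is "subloop ?N Q")
proof -
  have Hc [simp]: "a \<in> carrier Q" if "a \<in> H" for a
    using that H by (auto simp: subloop_def)
  have Hm [simp]: "a \<otimes> b \<in> H" "ldiv Q a b \<in> H" "rdiv Q b a \<in> H" if "a \<in> H" "b \<in> H" for a b
    using that H by (auto simp: subloop_def)
  have H1 [simp]: "\<one> \<in> H"
    using H by (simp add: subloop_def)
  have mult: "a \<otimes> b \<in> ?N" if "a \<in> ?N" "b \<in> ?N" for a b
    using that by auto
  have ld: "ldiv Q a b \<in> ?N" if a: "a \<in> ?N" and b: "b \<in> ?N" for a b
  proof -
    let ?c = "ldiv Q a b"
    have "(?c \<otimes> v) \<otimes> w = ?c \<otimes> (v \<otimes> w)" if vw: "v \<in> H" "w \<in> H" for v w
    proof (rule l_cancel)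
      have "a \<otimes> ((?c \<otimes> v) \<otimes> w) = ((a \<otimes> ?c) \<otimes> v) \<otimes> w"
        using a b vw by (simp del: ldiv)
      also have "\<dots> = (a \<otimes> ?c) \<otimes> (v \<otimes> w)"
        using a b vw by simp
      also have "\<dots> = a \<otimes> (?c \<otimes> (v \<otimes> w))"
        using a b vw by (simp del: ldiv)
      finally show "a \<otimes> ((?c \<otimes> v) \<otimes> w) = a \<otimes> (?c \<otimes> (v \<otimes> w))" .
    qed (use a b vw in auto)
    then show ?thesis
      using a b by simp
  qed
  have one: "\<one> \<in> ?N"
    by simp
  \<comment> \<open>Since \<open>a\<close> associates from the left, its right inverse
    \<open>?a'\<close> is also a left inverse. Right division by \<open>a\<close> is then
    multiplication by \<open>?a'\<close>, and closure under products applies.\<close>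
  have rd: "rdiv Q b a \<in> ?N" if a: "a \<in> ?N" and b: "b \<in> ?N" for a b
  proof -
    let ?a' = "ldiv Q a \<one>"
    have a': "?a' \<in> ?N"
      by (rule ld[OF a one])
    have "a \<otimes> (?a' \<otimes> a) = (a \<otimes> ?a') \<otimes> a"
      using a by (simp del: ldiv)
    then have "?a' \<otimes> a = \<one>"
      using a l_cancel[of a "?a' \<otimes> a" \<one>] by simp
    then have "(b \<otimes> ?a') \<otimes> a = b"
      using a b by simp
    then have "rdiv Q b a = b \<otimes> ?a'"
      using a b rdiv_mult[of a "b \<otimes> ?a'"] by simp
    then show ?thesis
      using mult[OF b a'] by simp
  qed
  show ?thesis
    unfolding subloop_def using mult ld rd one by auto
qed

end

section \<open>Automorphic loops\<close>

context automorphic_loop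
begin

declare two_sided_inverse [simp]

lemma left_inner_auto: "\<lbrakk>x \<in> carrier Q; y \<in> carrier Q\<rbrakk> \<Longrightarrow> left_inner Q x y \<in> auto Q"
  using Inn_subset_auto left_inner_in_Inn by blast

lemma middle_inner_auto: "\<lbrakk>x \<in> carrier Q; y \<in> carrier Q\<rbrakk> \<Longrightarrow> middle_inner Q x y \<in> auto Q"
  using Inn_subset_auto middle_inner_in_Inn by blast

lemma inv_eqI: "\<lbrakk>x \<in> carrier Q; y \<in> carrier Q; x \<otimes> y = \<one>\<rbrakk> \<Longrightarrow> inv x = y"
  using l_cancel[of x "inv x" y] by simp

lemma inv_inv [simp]: "x \<in> carrier Q \<Longrightarrow> inv (inv x) = x"
  by (rule inv_eqI) auto

lemma auto_closed: "\<lbrakk>f \<in> auto Q; x \<in> carrier Q\<rbrakk> \<Longrightarrow> f x \<in> carrier Q"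
  by (auto simp: auto_def hom_def)

lemma auto_mult: "\<lbrakk>f \<in> auto Q; x \<in> carrier Q; y \<in> carrier Q\<rbrakk> \<Longrightarrow> f (x \<otimes> y) = f x \<otimes> f y"
  by (auto simp: auto_def hom_def)

lemma auto_one: "f \<in> auto Q \<Longrightarrow> f \<one> = \<one>"
  using auto_mult[of f \<one> \<one>] auto_closed[of f \<one>] l_cancel[of "f \<one>" "f \<one>" \<one>] by simp

lemma auto_inv: "\<lbrakk>f \<in> auto Q; x \<in> carrier Q\<rbrakk> \<Longrightarrow> f (inv x) = inv (f x)"
  using auto_mult[of f x "inv x"] inv_eqI[of "f x" "f (inv x)"] by (simp add: auto_one auto_closed)

text \<open>The fixed points of an automorphism form a subloop: quotients are unique solutions of
  equations, so they are fixed along with their arguments.\<close>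

lemma auto_fixes_subloop_generated:
  assumes f: "f \<in> auto Q" and S: "S \<subseteq> carrier Q" "\<And>s. s \<in> S \<Longrightarrow> f s = s"
    and x: "x \<in> subloop_generated Q S"
  shows "f x = x"
proof -
  have ld: "f (ldiv Q a b) = ldiv Q a b"
    if "a \<in> carrier Q" "b \<in> carrier Q" "f a = a" "f b = b" for a b
    using that f auto_mult[of f a "ldiv Q a b"] ldiv_mult[of a "f (ldiv Q a b)"]
    by (simp add: auto_closed)
  have rd: "f (rdiv Q b a) = rdiv Q b a"
    if "a \<in> carrier Q" "b \<in> carrier Q" "f a = a" "f b = b" for a b
    using that f auto_mult[of f "rdiv Q b a" a] rdiv_mult[of a "f (rdiv Q b a)"]
    by (simp add: auto_closed)
  have "subloop {x \<in> carrier Q. f x = x} Q"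
    using f ld rd by (auto simp: subloop_def auto_one auto_mult)
  then show ?thesis
    using subloop_generated_least[of "{x \<in> carrier Q. f x = x}" S] S x by auto
qed

lemma flexible:
  assumes x: "x \<in> carrier Q" and y: "y \<in> carrier Q"
  shows "(x \<otimes> y) \<otimes> x = x \<otimes> (y \<otimes> x)"
proof -
  define T where "T = (\<lambda>y\<in>carrier Q. rdiv Q (x \<otimes> y) x)"
  have Tx: "T y \<otimes> x = x \<otimes> y" if "y \<in> carrier Q" for y
    using that x by (simp add: T_def)
  have "T \<one> = \<one>" "T x = x"
    using x rdiv_mult[of x \<one>] by (auto simp: T_def)
  then have "T \<in> auto Q"
    using Inn_subset_auto conj_in_Mlt[OF x] by (auto simp: Inn_def T_def)
  \<comment> \<open>\<open>T\<close> fixes \<open>x\<close>, so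
    \<open>T (y \<otimes> x) = T y \<otimes> x\<close>, which is \<open>x \<otimes> y\<close> by the
    definition of \<open>T\<close>. Multiplying by \<open>x\<close> gives flexibility.\<close>
  then have "T (y \<otimes> x) = x \<otimes> y"
    using x y \<open>T x = x\<close> Tx by (simp add: auto_mult)
  then show ?thesis
    using Tx[of "y \<otimes> x"] x y by simp
qed

lemma left_inner_fixes_left:
  "\<lbrakk>x \<in> carrier Q; y \<in> carrier Q\<rbrakk> \<Longrightarrow> left_inner Q x y x = x"
  by (simp add: left_inner_fixes_iff flexible)

lemma inv_mult:
  assumes w: "w \<in> carrier Q" and v: "v \<in> carrier Q"
  shows "inv (w \<otimes> v) = inv v \<otimes> inv w"
proof -
  \<comment> \<open>With \<open>x \<otimes> y = w\<close> and \<open>x = w \<otimes> v\<close>, the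
    mapping \<open>f\<close> sends the inverse of \<open>y\<close> to \<open>v\<close> and the
    solution \<open>u\<close> of \<open>y \<otimes> u = inv x\<close> to \<open>inv w\<close>.
    Applying \<open>f\<close> to that equation gives the claim.\<close>
  define x where "x = w \<otimes> v"
  define y where "y = ldiv Q x w"
  define f where "f = left_inner Q x y"
  have xy [simp]: "x \<in> carrier Q" "y \<in> carrier Q" "x \<otimes> y = w"
    using w v by (auto simp: x_def y_def)
  have f: "f \<in> auto Q"
    by (simp add: f_def left_inner_auto)
  have "f (inv x) = inv x"
    using auto_inv[OF f, of x] by (simp add: f_def left_inner_fixes_left)
  moreover have "f (inv y) = v"
    unfolding f_def by (rule left_inner_eqI) (use w v in \<open>simp_all add: x_def [symmetric]\<close>)
  then have "f y = inv v"
    using auto_inv[OF f, of "inv y"] by simp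
  moreover have "f (ldiv Q y (inv x)) = inv w"
    unfolding f_def by (rule left_inner_eqI) (use w v in auto)
  ultimately have "inv x = inv v \<otimes> inv w"
    using auto_mult[OF f, of y "ldiv Q y (inv x)"] by simp
  then show ?thesis
    by (simp add: x_def)
qed

lemma inv_inject: "\<lbrakk>x \<in> carrier Q; y \<in> carrier Q; inv x = inv y\<rbrakk> \<Longrightarrow> x = y"
  by (metis inv_inv)

section \<open>Exchange of left and right laws by inversion\<close>

lemma left_alternative_iff_right: "left_alternative Q \<longleftrightarrow> right_alternative Q"
proof
  assume l: "left_alternative Q"
  show "right_alternative Q"
    unfolding right_alternative_def
  proof (intro ballI)
    fix x y assume xy [simp]: "x \<in> carrier Q" "y \<in> carrier Q"
    \<comment> \<open>The law is taken at inverses in reversed order; inverting both sides then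
      yields its mirror image.\<close>
    have "inv y \<otimes> (inv y \<otimes> inv x) = (inv y \<otimes> inv y) \<otimes> inv x"
      using l by (simp add: left_alternative_def)
    then show "x \<otimes> (y \<otimes> y) = (x \<otimes> y) \<otimes> y"
      by - (rule inv_inject, simp_all add: inv_mult)
  qed
next
  assume r: "right_alternative Q"
  show "left_alternative Q"
    unfolding left_alternative_def
  proof (intro ballI)
    fix x y assume xy [simp]: "x \<in> carrier Q" "y \<in> carrier Q"
    have "inv y \<otimes> (inv x \<otimes> inv x) = (inv y \<otimes> inv x) \<otimes> inv x"
      using r by (simp add: right_alternative_def)
    then show "x \<otimes> (x \<otimes> y) = (x \<otimes> x) \<otimes> y"
      by - (rule inv_inject, simp_all add: inv_mult)
  qed
qed

lemma left_inverse_iff_right: "left_inverse_property Q \<longleftrightarrow> right_inverse_property Q"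
proof
  assume l: "left_inverse_property Q"
  show "right_inverse_property Q"
    unfolding right_inverse_property_def
  proof (intro ballI)
    fix x y assume xy [simp]: "x \<in> carrier Q" "y \<in> carrier Q"
    have "inv (inv y) \<otimes> (inv y \<otimes> inv x) = inv x"
      using l two_sided_inverse(1) xy unfolding left_inverse_property_def by blast
    then show "(x \<otimes> y) \<otimes> inv y = x"
      by - (rule inv_inject, simp_all add: inv_mult)
  qed
next
  assume r: "right_inverse_property Q"
  show "left_inverse_property Q"
    unfolding left_inverse_property_def
  proof (intro ballI)
    fix x y assume xy [simp]: "x \<in> carrier Q" "y \<in> carrier Q"
    have "(inv y \<otimes> inv x) \<otimes> inv (inv x) = inv y"
      using r two_sided_inverse(1) xy unfolding right_inverse_property_def by blast
    then show "inv x \<otimes> (x \<otimes> y) = y"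
      by - (rule inv_inject, simp_all add: inv_mult)
  qed
qed

text \<open>The right inverse property makes the left inner mapping of \<open>x, y\<close> fix
  \<open>inv y\<close>. Being an automorphism it fixes \<open>y\<close> too, which is the right
  alternative law.\<close>

lemma right_alternative_if_right_inverse:
  assumes "right_inverse_property Q"
  shows "right_alternative Q"
  unfolding right_alternative_def
proof (intro ballI)
  fix x y assume xy [simp]: "x \<in> carrier Q" "y \<in> carrier Q"
  have "left_inner Q x y (inv y) = inv y"
    using assms by (simp add: left_inner_fixes_iff right_inverse_property_def)
  then have "left_inner Q x y y = y"
    using auto_inv[OF left_inner_auto, of x y "inv y"] by simp
  then show "x \<otimes> (y \<otimes> y) = (x \<otimes> y) \<otimes> y"
    by (simp add: left_inner_fixes_iff)
qed

section \<open>Alternative automorphic loops\<close>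

lemma middle_inner_fixes:
  assumes "left_alternative Q" "x \<in> carrier Q" "y \<in> carrier Q"
  shows "middle_inner Q x y x = x" "middle_inner Q x y y = y"
  using assms left_alternative_iff_right
  by (simp_all add: middle_inner_fixes_iff left_alternative_def right_alternative_def)

lemma generator_in_left_nucleus:
  assumes alt: "left_alternative Q" and xy: "x \<in> carrier Q" "y \<in> carrier Q"
    and vw: "v \<in> subloop_generated Q {x, y}" "w \<in> subloop_generated Q {x, y}"
  shows "(x \<otimes> v) \<otimes> w = x \<otimes> (v \<otimes> w)"
proof -
  have "subloop (subloop_generated Q {x, y}) Q"
    using xy by (simp add: subloop_subloop_generated)
  then have vw': "v \<in> carrier Q" "w \<in> carrier Q"
    using vw by (auto simp: subloop_def)
  have "middle_inner Q x y v = v"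
    by (rule auto_fixes_subloop_generated[of _ "{x, y}"])
      (use xy vw alt in \<open>auto simp: middle_inner_auto middle_inner_fixes\<close>)
  \<comment> \<open>The same equation
    \<open>(x \<otimes> v) \<otimes> y = x \<otimes> (v \<otimes> y)\<close> is now read as a fixed
    point of a left inner mapping.\<close>
  then have "left_inner Q x v y = y"
    using xy vw' by (simp add: middle_inner_fixes_iff left_inner_fixes_iff)
  then have "left_inner Q x v w = w"
    by - (rule auto_fixes_subloop_generated[of _ "{x, y}"],
      use xy vw vw' in \<open>auto simp: left_inner_auto left_inner_fixes_left\<close>)
  then show ?thesis
    using xy vw' by (simp add: left_inner_fixes_iff)
qed

lemma diassociative_if_left_alternative:
  assumes alt: "left_alternative Q"
  shows "diassociative Q"
  unfolding diassociative_def associative_on_def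
proof (intro ballI)
  fix x y u v w
  assume xy: "x \<in> carrier Q" "y \<in> carrier Q"
    and uvw: "u \<in> subloop_generated Q {x, y}" "v \<in> subloop_generated Q {x, y}"
      "w \<in> subloop_generated Q {x, y}"
  let ?H = "subloop_generated Q {x, y}"
  let ?N = "{a \<in> ?H. \<forall>v\<in>?H. \<forall>w\<in>?H. (a \<otimes> v) \<otimes> w = a \<otimes> (v \<otimes> w)}"
  have "subloop ?N Q"
    using xy by (simp add: subloop_left_nucleus subloop_subloop_generated)
  moreover have "{x, y} \<subseteq> ?N"
    using generator_in_left_nucleus[OF alt xy] generator_in_left_nucleus[OF alt xy(2,1)]
      subloop_generated_subset[of "{x, y}"] by (auto simp: insert_commute)
  ultimately have "?H \<subseteq> ?N"
    by (rule subloop_generated_least)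
  then show "(u \<otimes> v) \<otimes> w = u \<otimes> (v \<otimes> w)"
    using uvw by blast
qed

section \<open>Return to the inverse properties\<close>

lemma left_inverse_if_diassociative:
  assumes di: "diassociative Q"
  shows "left_inverse_property Q"
  unfolding left_inverse_property_def
proof (intro ballI)
  fix x y assume xy [simp]: "x \<in> carrier Q" "y \<in> carrier Q"
  let ?H = "subloop_generated Q {x, y}"
  have H: "subloop ?H Q" "x \<in> ?H" "y \<in> ?H"
    using subloop_subloop_generated[of "{x, y}"] subloop_generated_subset[of "{x, y}"] by auto
  have "inv x = ldiv Q x \<one>"
    by (rule inv_eqI) auto
  then have "inv x \<in> ?H"
    using H by (auto simp: subloop_def)
  moreover have "associative_on Q ?H"
    using di by (simp add: diassociative_def)
  ultimately have "(inv x \<otimes> x) \<otimes> y = inv x \<otimes> (x \<otimes> y)"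
    using H unfolding associative_on_def by blast
  then show "inv x \<otimes> (x \<otimes> y) = y"
    by simp
qed

lemma right_inverse_if_moufang:
  assumes "moufang Q"
  shows "right_inverse_property Q"
  unfolding right_inverse_property_def
proof (intro ballI)
  fix x y assume xy [simp]: "x \<in> carrier Q" "y \<in> carrier Q"
  let ?z = "inv y"
  \<comment> \<open>The Moufang identity with outer element \<open>inv y\<close> makes
    \<open>y \<otimes> ?z\<close> vanish; flexibility then exposes a left factor \<open>?z\<close>
    to cancel.\<close>
  have "(?z \<otimes> x) \<otimes> (y \<otimes> ?z) = (?z \<otimes> (x \<otimes> y)) \<otimes> ?z"
    using assms two_sided_inverse(1) xy unfolding moufang_def by blast
  then have "?z \<otimes> x = ?z \<otimes> ((x \<otimes> y) \<otimes> ?z)"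
    by (simp add: flexible)
  then show "(x \<otimes> y) \<otimes> ?z = x"
    using l_cancel[of ?z x "(x \<otimes> y) \<otimes> ?z"] by simp
qed

end

section \<open>The Moufang identity\<close>

locale inverse_property_automorphic_loop = automorphic_loop +
  assumes inv_mult_cancel [simp]:
      "\<lbrakk>x \<in> carrier Q; y \<in> carrier Q\<rbrakk> \<Longrightarrow> inv x \<otimes> (x \<otimes> y) = y"
    and mult_inv_cancel [simp]:
      "\<lbrakk>x \<in> carrier Q; y \<in> carrier Q\<rbrakk> \<Longrightarrow> (x \<otimes> y) \<otimes> inv y = x"
begin

lemma mult_inv_cancel_left [simp]:
  "\<lbrakk>x \<in> carrier Q; y \<in> carrier Q\<rbrakk> \<Longrightarrow> x \<otimes> (inv x \<otimes> y) = y"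
  using inv_mult_cancel[of "inv x" y] by simp

lemma mult_inv_cancel_right [simp]:
  "\<lbrakk>x \<in> carrier Q; y \<in> carrier Q\<rbrakk> \<Longrightarrow> (x \<otimes> inv y) \<otimes> y = x"
  using mult_inv_cancel[of x "inv y"] by simp

lemma right_alternative: "right_alternative Q"
  by (rule right_alternative_if_right_inverse) (simp add: right_inverse_property_def)

lemma mult_mult_right:
  "\<lbrakk>x \<in> carrier Q; y \<in> carrier Q\<rbrakk> \<Longrightarrow> (x \<otimes> y) \<otimes> y = x \<otimes> (y \<otimes> y)"
  using right_alternative by (simp add: right_alternative_def)

lemma left_alternative: "left_alternative Q"
  using right_alternative left_alternative_iff_right by simp

lemma left_inner_fixes_right:
  "\<lbrakk>x \<in> carrier Q; y \<in> carrier Q\<rbrakk> \<Longrightarrow> left_inner Q x y y = y"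
  by (simp add: left_inner_fixes_iff mult_mult_right)

text \<open>The mapping fixes \<open>x\<close> and \<open>y\<close>, hence
  \<open>x \<otimes> y\<close>, so it acts only on the factor \<open>z\<close>. It thus reassociates
  the whole product.\<close>

lemma left_inner_assoc:
  assumes "x \<in> carrier Q" "y \<in> carrier Q" "z \<in> carrier Q"
  shows "left_inner Q x y ((x \<otimes> y) \<otimes> z) = x \<otimes> (y \<otimes> z)"
  using assms
  by (simp add: auto_mult left_inner_auto left_inner_fixes_left left_inner_fixes_right mult_left_inner)

lemma middle_inner_assoc:
  assumes "x \<in> carrier Q" "y \<in> carrier Q" "z \<in> carrier Q"
  shows "middle_inner Q x z ((x \<otimes> y) \<otimes> z) = x \<otimes> (y \<otimes> z)"
  using assms
  by (simp add: auto_mult middle_inner_auto middle_inner_fixes left_alternative mult_middle_inner)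

section \<open>Relations between middle inner mappings\<close>

lemma middle_inner_inv_left_comp:
  assumes [simp]: "x \<in> carrier Q" "y \<in> carrier Q" "z \<in> carrier Q"
  shows "middle_inner Q x y (middle_inner Q (inv x) y z) = z"
proof -
  define f where "f = middle_inner Q x y"
  have f: "f \<in> auto Q" "f x = x" "f (inv x) = inv x"
    using auto_inv[OF middle_inner_auto, of x y x]
    by (simp_all add: f_def middle_inner_auto middle_inner_fixes left_alternative)
  \<comment> \<open>Chosen so that \<open>z = (inv x \<otimes> u) \<otimes> y\<close>, a form that
    \<open>middle_inner_assoc\<close> can reassociate.\<close>
  define u where "u = x \<otimes> (z \<otimes> inv y)"
  have u [simp]: "u \<in> carrier Q" and z: "z = (inv x \<otimes> u) \<otimes> y"
    by (auto simp: u_def)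
  have "f (u \<otimes> y) = x \<otimes> ((inv x \<otimes> u) \<otimes> y)"
    using middle_inner_assoc[of x "inv x \<otimes> u" y] by (simp add: f_def)
  then have "f (inv x \<otimes> (u \<otimes> y)) = (inv x \<otimes> u) \<otimes> y"
    using f by (simp add: auto_mult)
  then show ?thesis
    using middle_inner_assoc[of "inv x" u y] by (simp add: f_def z)
qed

text \<open>Inverting the products in \<open>middle_inner_assoc\<close> reverses the direction of
  reassociation, and automorphisms commute with inversion.\<close>

lemma middle_inner_inv_inv_comp:
  assumes [simp]: "x \<in> carrier Q" "y \<in> carrier Q" "z \<in> carrier Q"
  shows "middle_inner Q x y (middle_inner Q (inv y) (inv x) z) = z"
proof -
  define u where "u = inv (y \<otimes> (z \<otimes> x))"
  have u [simp]: "u \<in> carrier Q" and z: "z = (inv y \<otimes> inv u) \<otimes> inv x"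
    by (auto simp: u_def)
  have "middle_inner Q x y (inv ((x \<otimes> u) \<otimes> y)) = inv (x \<otimes> (u \<otimes> y))"
    by (simp add: auto_inv middle_inner_auto middle_inner_assoc)
  then show ?thesis
    using middle_inner_assoc[of "inv y" "inv u" "inv x"] by (simp add: z inv_mult)
qed

lemma middle_inner_swap:
  assumes [simp]: "x \<in> carrier Q" "y \<in> carrier Q" "z \<in> carrier Q"
  shows "middle_inner Q (inv x) y z = middle_inner Q y x z"
    and "middle_inner Q x (inv y) z = middle_inner Q y x z"
proof -
  \<comment> \<open>Both sides invert \<open>middle_inner Q a b\<close>, by the two preceding
    lemmas.\<close>
  have inv_left: "middle_inner Q (inv a) b z = middle_inner Q (inv b) (inv a) z"
    if [simp]: "a \<in> carrier Q" "b \<in> carrier Q" for a b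
    using middle_inner_inv_left_comp[of "inv a" b "middle_inner Q (inv b) (inv a) z"]
    by (simp add: middle_inner_inv_inv_comp)
  show swap: "middle_inner Q (inv x) y z = middle_inner Q y x z"
    using inv_left[of "inv y" x] by simp
  show "middle_inner Q x (inv y) z = middle_inner Q y x z"
    using inv_left[of y "inv x"] inv_left[of x y] swap by simp
qed

section \<open>Comparison of left and middle inner mappings\<close>

lemma left_inner_mult_right:
  assumes [simp]: "x \<in> carrier Q" "y \<in> carrier Q" "z \<in> carrier Q"
  shows "left_inner Q x (y \<otimes> z) z = left_inner Q x y z"
proof (rule left_inner_eqI)
  let ?f = "left_inner Q x y"
  have "(x \<otimes> (y \<otimes> z)) \<otimes> ?f z = ((x \<otimes> y) \<otimes> ?f z) \<otimes> ?f z"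
    by (simp add: mult_left_inner)
  also have "\<dots> = (x \<otimes> y) \<otimes> ?f (z \<otimes> z)"
    by (simp add: mult_mult_right auto_mult left_inner_auto)
  also have "\<dots> = x \<otimes> ((y \<otimes> z) \<otimes> z)"
    by (simp add: mult_left_inner mult_mult_right)
  finally show "(x \<otimes> (y \<otimes> z)) \<otimes> ?f z = x \<otimes> ((y \<otimes> z) \<otimes> z)" .
qed auto

lemma left_inner_eq_middle_inner_mult:
  assumes [simp]: "x \<in> carrier Q" "y \<in> carrier Q" "z \<in> carrier Q"
  shows "left_inner Q x y z = middle_inner Q y (x \<otimes> z) z"
proof -
  \<comment> \<open>The inverse of \<open>x \<otimes> y\<close>. Both mappings lead to
    \<open>y \<otimes> (?a \<otimes> (x \<otimes> z))\<close>: the left one from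
    \<open>x \<otimes> z\<close> after cancelling \<open>x\<close>, the middle one from
    \<open>(y \<otimes> ?a) \<otimes> (x \<otimes> z) = z\<close>.\<close>
  let ?a = "inv y \<otimes> inv x"
  have "left_inner Q x y (x \<otimes> z) = x \<otimes> (y \<otimes> (?a \<otimes> (x \<otimes> z)))"
    using left_inner_assoc[of x y "?a \<otimes> (x \<otimes> z)"] mult_inv_cancel_left[of "x \<otimes> y" "x \<otimes> z"]
    by (simp add: inv_mult)
  then have "x \<otimes> left_inner Q x y z = x \<otimes> (y \<otimes> (?a \<otimes> (x \<otimes> z)))"
    by (simp add: auto_mult left_inner_auto left_inner_fixes_left)
  then have "left_inner Q x y z = y \<otimes> (?a \<otimes> (x \<otimes> z))"
    by (rule l_cancel[rotated 3]) auto
  also have "\<dots> = middle_inner Q y (x \<otimes> z) z"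
    using middle_inner_assoc[of y ?a "x \<otimes> z"] by simp
  finally show ?thesis .
qed

lemma left_inner_eq_middle_inner:
  assumes [simp]: "x \<in> carrier Q" "y \<in> carrier Q" "z \<in> carrier Q"
  shows "left_inner Q x y z = middle_inner Q y x z"
proof -
  have "middle_inner Q y x z = middle_inner Q x (inv y) z"
    by (simp add: middle_inner_swap)
  \<comment> \<open>The factor \<open>inv y \<otimes> inv z\<close> is chosen because its product
    with \<open>z\<close> is \<open>inv y\<close>. In left form, \<open>x\<close> may be replaced by
    \<open>x \<otimes> z\<close>.\<close>
  also have "\<dots> = left_inner Q (inv y \<otimes> inv z) x z"
    by (simp add: left_inner_eq_middle_inner_mult)
  also have "\<dots> = left_inner Q (inv y \<otimes> inv z) (x \<otimes> z) z"
    by (simp add: left_inner_mult_right)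
  also have "\<dots> = middle_inner Q (x \<otimes> z) (inv y) z"
    by (simp add: left_inner_eq_middle_inner_mult)
  also have "\<dots> = middle_inner Q y (x \<otimes> z) z"
    by (simp add: middle_inner_swap)
  also have "\<dots> = left_inner Q x y z"
    by (simp add: left_inner_eq_middle_inner_mult)
  finally show ?thesis by simp
qed

lemma moufang: "moufang Q"
  unfolding moufang_def
proof (intro ballI)
  fix x y z assume [simp]: "x \<in> carrier Q" "y \<in> carrier Q" "z \<in> carrier Q"
  define f where "f = left_inner Q x y"
  \<comment> \<open>The preimage of \<open>z\<close> under \<open>f\<close>, obtained by solving
    \<open>x \<otimes> (y \<otimes> u) = (x \<otimes> y) \<otimes> z\<close>.\<close>
  define u where "u = (inv y \<otimes> (inv x \<otimes> ((x \<otimes> y) \<otimes> z)))"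
  have f: "f \<in> auto Q" "f x = x" "f y = y"
    by (simp_all add: f_def left_inner_auto left_inner_fixes_left left_inner_fixes_right)
  have u [simp]: "u \<in> carrier Q" and fu: "f u = z"
    unfolding f_def u_def by (simp_all add: left_inner_eqI)
  have "(x \<otimes> y) \<otimes> (z \<otimes> x) = f ((x \<otimes> y) \<otimes> (u \<otimes> x))"
    using f fu by (simp add: auto_mult)
  also have "\<dots> = x \<otimes> (y \<otimes> (u \<otimes> x))"
    by (simp add: f_def left_inner_assoc)
  \<comment> \<open>Here \<open>f\<close> is used as the middle inner mapping of
    \<open>y, x\<close>, which reassociates \<open>(y \<otimes> u) \<otimes> x\<close>.\<close>
  also have "y \<otimes> (u \<otimes> x) = f ((y \<otimes> u) \<otimes> x)"
    by (simp add: f_def left_inner_eq_middle_inner middle_inner_assoc)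
  also have "\<dots> = (y \<otimes> z) \<otimes> x"
    using f fu by (simp add: auto_mult)
  finally show "(x \<otimes> y) \<otimes> (z \<otimes> x) = (x \<otimes> (y \<otimes> z)) \<otimes> x"
    by (simp add: flexible)
qed

end

lemma (in automorphic_loop) moufang_if_left_inverse:
  assumes "left_inverse_property Q"
  shows "moufang Q"
proof -
  interpret inverse_property_automorphic_loop Q
    using assms left_inverse_iff_right
    by unfold_locales (auto simp: left_inverse_property_def right_inverse_property_def)
  show ?thesis
    by (rule moufang)
qed

theorem theorem1p12:
  fixes Q :: "('a, 'b) monoid_scheme"
  assumes "automorphic_loop Q"
  shows "(left_alternative Q \<longleftrightarrow> right_alternative Q) \<and>
         (right_alternative Q \<longleftrightarrow> left_inverse_property Q) \<and>
         (left_inverse_property Q \<longleftrightarrow> right_inverse_property Q) \<and>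
         (right_inverse_property Q \<longleftrightarrow> diassociative Q) \<and>
         (diassociative Q \<longleftrightarrow> moufang Q)"
proof -
  interpret automorphic_loop Q by fact
  \<comment> \<open>The implications form a cycle: left alternative, diassociative, left inverse,
    Moufang, right inverse, right alternative, left alternative.\<close>
  show ?thesis
    using left_alternative_iff_right left_inverse_iff_right right_alternative_if_right_inverse
      diassociative_if_left_alternative left_inverse_if_diassociative moufang_if_left_inverse
      right_inverse_if_moufang
    by blast
qed

end
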